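(* Let $k\geq 1$ and let $m_1\leq m_2\leq \dots \leq m_k$ be positive integers, and let $n$ be an integer with $n\geq 3m_k+5m_{k-1}$. Then $$R(C_{\geq n}, K_{m_1, \dots, m_k})= (k-1)(n-1)+m_1.$$
   Context: $K_{m_1,\dots,m_k}$ denotes the complete $k$-partite graph with parts of sizes $m_1,\dots,m_k$ (all edges between distinct parts, none inside parts). $R(C_{\geq n}, H)$ is the smallest integer $N$ such that every red-blue coloring of the edges of the complete graph $K_N$ contains either a red cycle of length at least $n$ or a blue copy of $H$. *)

theory Defs
  imports "HOL-Library.Ramsey"
begin

text \<open>Edges are two-element sets of vertices; the record itself does not enforce this.\<close>

record 'a sgraph =
  verts :: "'a set"
  edges :: "'a set set"

definition complete_graph :: "nat \<Rightarrow> nat sgraph" where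
  "complete_graph N = \<lparr>verts = {..<N}, edges = nsets {..<N} 2\<rparr>"

text \<open>The cycle of length \<open>l\<close>; this is only a cycle in the sense of simple graphs for \<open>l \<ge> 3\<close>.\<close>

definition cycle_graph :: "nat \<Rightarrow> nat sgraph" where
  "cycle_graph l = \<lparr>verts = {..<l}, edges = {{i, Suc i mod l} | i. i < l}\<rparr>"

text \<open>The vertex \<open>(i, j)\<close> is the \<open>j\<close>-th vertex of the \<open>i\<close>-th part, parts being numbered from 1.\<close>

definition complete_multipartite :: "nat \<Rightarrow> (nat \<Rightarrow> nat) \<Rightarrow> (nat \<times> nat) sgraph" where
  "complete_multipartite k m =
     (let V = (SIGMA i:{1..k}. {..<m i})
      in \<lparr>verts = V, edges = {{x, y} | x y. x \<in> V \<and> y \<in> V \<and> fst x \<noteq> fst y}\<rparr>)"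

text \<open>Copies are subgraphs, not necessarily induced ones.\<close>

definition contains_copy :: "'a sgraph \<Rightarrow> 'b sgraph \<Rightarrow> bool" where
  "contains_copy G H \<longleftrightarrow>
     (\<exists>f. inj_on f (verts H) \<and> f ` verts H \<subseteq> verts G \<and> (\<forall>e\<in>edges H. f ` e \<in> edges G))"

definition contains_cycle_at_least :: "nat \<Rightarrow> 'a sgraph \<Rightarrow> bool" where
  "contains_cycle_at_least n G \<longleftrightarrow> (\<exists>l. 3 \<le> l \<and> n \<le> l \<and> contains_copy G (cycle_graph l))"

datatype colour = Red | Blue

text \<open>An edge colouring is a total function on sets of vertices, of which only the values on the
  edges of the graph are relevant.\<close>

definition colour_class :: "('a set \<Rightarrow> colour) \<Rightarrow> colour \<Rightarrow> 'a sgraph \<Rightarrow> 'a sgraph" where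
  "colour_class c a G = \<lparr>verts = verts G, edges = {e \<in> edges G. c e = a}\<rparr>"

text \<open>The Ramsey number \<open>R(C\<^bsub>\<ge> n\<^esub>, H)\<close>.\<close>

definition ramsey_long_cycle :: "nat \<Rightarrow> 'b sgraph \<Rightarrow> nat" where
  "ramsey_long_cycle n H =
     (LEAST N. \<forall>c :: nat set \<Rightarrow> colour.
        contains_cycle_at_least n (colour_class c Red (complete_graph N)) \<or>
        contains_copy (colour_class c Blue (complete_graph N)) H)"

end

theory Submission
  imports Defs
begin

text \<open>For the upper bound we induct on \<open>k\<close>. A red neighbourhood that is too small, of a set of \<open>m\<^sub>k\<close> or of
  \<open>m\<^sub>k\<^sub>-\<^sub>1\<close> vertices, lets us take this set as one part of the blue graph and find the other parts
  outside its closed neighbourhood. Otherwise, with \<open>a = m\<^sub>k\<^sub>-\<^sub>1\<close>, delete a maximal set \<open>B\<close> of at most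
  \<open>a\<close> vertices with at most \<open>2|B|\<close> neighbours; in the rest all sets of at most \<open>a\<close> vertices expand by
  more than a factor of two. Posa rotations of a longest path yield a cycle containing a set \<open>T\<close> of path
  ends together with all its neighbours. Counting only the neighbours of \<open>a\<close> ends whose rotations break
  few edges gives \<open>|T| > m\<^sub>k + 2a\<close>, which leaves \<open>m\<^sub>k\<close> ends not adjacent to \<open>B\<close>; their closed
  neighbourhood has at least \<open>n\<close> vertices and lies on the cycle.\<close>

section \<open>Edges of paths given as vertex lists\<close>

fun path_edges :: "'a list \<Rightarrow> 'a set set" where
  "path_edges (x # y # zs) = insert {x, y} (path_edges (y # zs))"
| "path_edges _ = {}"

lemma path_edges_append:
  "path_edges (xs @ ys) = path_edges xs \<union> path_edges ys \<union>
     (if xs \<noteq> [] \<and> ys \<noteq> [] then {{last xs, hd ys}} else {})"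
proof (induction xs rule: path_edges.induct)
  case (1 x y zs)
  then show ?case by auto
next
  case ("2_2" v)
  then show ?case by (cases ys) auto
qed auto

text \<open>Edges are unordered pairs, so a rotation, which reverses an initial segment, keeps the
  edges inside that segment.\<close>

lemma path_edges_rev: "path_edges (rev xs) = path_edges xs"
proof (induction xs rule: path_edges.induct)
  case (1 x y zs)
  then show ?case
    using path_edges_append[of "rev zs @ [y]" "[x]"] by (simp add: insert_commute)
qed auto

lemma path_edges_subset_set: "e \<in> path_edges xs \<Longrightarrow> e \<subseteq> set xs"
  by (induction xs rule: path_edges.induct) auto

lemma path_edges_split_iff:
  assumes "distinct (xs @ y # ys)"
  shows "{y, w} \<in> path_edges (xs @ y # ys) \<longleftrightarrow>
    xs \<noteq> [] \<and> w = last xs \<or> ys \<noteq> [] \<and> w = hd ys"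
proof -
  have y: "y \<notin> set xs" "y \<notin> set ys"
    using assms by auto
  have "{y, w} \<notin> path_edges xs" "{y, w} \<notin> path_edges ys"
    using y by (auto dest: path_edges_subset_set)
  moreover have "path_edges (y # ys) = path_edges ys \<union> (if ys \<noteq> [] then {{y, hd ys}} else {})"
    by (cases ys) auto
  ultimately show ?thesis
    by (auto simp: path_edges_append doubleton_eq_iff)
qed

lemma card_path_neighbours_le:
  assumes "distinct q"
  shows "finite {w. {s, w} \<in> path_edges q} \<and> card {w. {s, w} \<in> path_edges q} \<le> 2"
proof (cases "s \<in> set q")
  case True
  then obtain xs ys where q: "q = xs @ s # ys"
    by (meson split_list)
  \<comment> \<open>If \<open>xs\<close> or \<open>ys\<close> is empty, \<open>last xs\<close> or
    \<open>hd ys\<close> is an unspecified value; the inclusion still holds.\<close>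
  have sub: "{w. {s, w} \<in> path_edges q} \<subseteq> {last xs, hd ys}"
    using path_edges_split_iff assms unfolding q by fastforce
  moreover have "card {last xs, hd ys} \<le> 2"
    by (simp add: card_insert_if)
  ultimately show ?thesis
    by (meson card_mono finite.emptyI finite.insertI finite_subset le_trans)
next
  case False
  then have "{w. {s, w} \<in> path_edges q} = {}"
    using path_edges_subset_set by fastforce
  then show ?thesis by simp
qed

text \<open>A union bound. Its factor two is what the expansion of small sets has to beat.\<close>

lemma card_path_neighbours_set_le:
  assumes "distinct q" "finite A"
  shows "finite {w. \<exists>s\<in>A. {s, w} \<in> path_edges q} \<and>
    card {w. \<exists>s\<in>A. {s, w} \<in> path_edges q} \<le> 2 * card A"
proof -
  have eq: "{w. \<exists>s\<in>A. {s, w} \<in> path_edges q} = (\<Union>s\<in>A. {w. {s, w} \<in> path_edges q})"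
    by auto
  have "card (\<Union>s\<in>A. {w. {s, w} \<in> path_edges q}) \<le> (\<Sum>s\<in>A. card {w. {s, w} \<in> path_edges q})"
    using assms(2) by (rule card_UN_le)
  also have "\<dots> \<le> (\<Sum>s\<in>A. 2)"
    using card_path_neighbours_le[OF assms(1)] by (intro sum_mono) blast
  finally show ?thesis
    using eq assms card_path_neighbours_le[OF assms(1)] by (simp add: mult.commute)
qed

section \<open>Neighbourhoods, paths and Posa rotations\<close>

definition nbhd :: "('a \<Rightarrow> 'a \<Rightarrow> bool) \<Rightarrow> 'a set \<Rightarrow> 'a set \<Rightarrow> 'a set" where
  "nbhd E V S = {y \<in> V - S. \<exists>s\<in>S. E s y}"

lemma finite_nbhd [simp]: "finite V \<Longrightarrow> finite (nbhd E V S)"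
  by (simp add: nbhd_def)

definition path_in :: "('a \<Rightarrow> 'a \<Rightarrow> bool) \<Rightarrow> 'a set \<Rightarrow> 'a list \<Rightarrow> bool" where
  "path_in E V p \<longleftrightarrow> p \<noteq> [] \<and> distinct p \<and> set p \<subseteq> V \<and> successively E p"

text \<open>Lists of length one or two are not excluded; only lists of length at least
  \<open>n\<close>, with \<open>3 \<le> n\<close>, are turned into cycles of the graph.\<close>

definition cycle_in :: "('a \<Rightarrow> 'a \<Rightarrow> bool) \<Rightarrow> 'a set \<Rightarrow> 'a list \<Rightarrow> bool" where
  "cycle_in E V p \<longleftrightarrow> path_in E V p \<and> E (last p) (hd p)"

text \<open>Posa rotation: the edge from the head to \<open>y\<close> replaces the edge from
  \<open>last xs\<close> to \<open>y\<close>, and \<open>last xs\<close> becomes the new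
  head.\<close>

lemma path_in_rotate:
  assumes "symp E" "path_in E V (xs @ y # ys)" "xs \<noteq> []" "E (hd xs) y"
  shows "path_in E V (rev xs @ y # ys)"
  using assms by (auto simp: path_in_def successively_append_iff successively_rev last_rev
      dest: sympD elim: successively_mono)

definition rotations :: "('a \<Rightarrow> 'a \<Rightarrow> bool) \<Rightarrow> 'a set \<Rightarrow> 'a list \<Rightarrow> 'a list set" where
  "rotations E V q0 = {q. path_in E V q \<and> set q = set q0 \<and> last q = last q0}"

text \<open>The elements of \<open>A\<close> arise as heads of rotations which only break edges of \<open>q0\<close> that
  meet \<open>A\<close>; so a vertex away from \<open>A\<close> still has its neighbours from \<open>q0\<close>.\<close>

definition rotation_closed :: "('a \<Rightarrow> 'a \<Rightarrow> bool) \<Rightarrow> 'a set \<Rightarrow> 'a list \<Rightarrow> 'a set \<Rightarrow> bool" where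
  "rotation_closed E V q0 A \<longleftrightarrow> hd q0 \<in> A \<and>
     (\<forall>s\<in>A. \<exists>q \<in> rotations E V q0. hd q = s \<and> (\<forall>e \<in> path_edges q0. e \<in> path_edges q \<or> e \<inter> A \<noteq> {}))"

definition confined :: "('a \<Rightarrow> 'a \<Rightarrow> bool) \<Rightarrow> 'a set \<Rightarrow> 'a list \<Rightarrow> bool" where
  "confined E V q0 \<longleftrightarrow> (\<forall>q \<in> rotations E V q0. \<forall>y \<in> V. E (hd q) y \<longrightarrow> y \<in> set q0)"

text \<open>Rotate at \<open>y\<close> a path whose head lies in \<open>A\<close> and is adjacent to
  \<open>y\<close>. Since neither \<open>y\<close> nor its neighbours on \<open>q0\<close> lie in
  \<open>A\<close>, the edges of \<open>q0\<close> at \<open>y\<close> are intact, so the edge that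
  breaks is one of them, and its other end is new.\<close>

lemma rotation_closed_extend:
  assumes sym: "symp E"
    and confined: "confined E V q0"
    and q0: "path_in E V q0"
    and A: "rotation_closed E V q0 A"
    and y: "y \<in> nbhd E V A"
    and away: "\<forall>w. {y, w} \<in> path_edges q0 \<longrightarrow> w \<notin> A"
  obtains z where "{y, z} \<in> path_edges q0" "z \<notin> A" "rotation_closed E V q0 (insert z A)"
proof -
  obtain s where s: "s \<in> A" "E s y" and yA: "y \<notin> A" "y \<in> V"
    using y by (auto simp: nbhd_def)
  obtain q where q: "q \<in> rotations E V q0" "hd q = s"
      "\<And>e. e \<in> path_edges q0 \<Longrightarrow> e \<in> path_edges q \<or> e \<inter> A \<noteq> {}"
    using A s(1) unfolding rotation_closed_def by metis
  have qs: "path_in E V q" "set q = set q0" "last q = last q0"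
    using q(1) by (auto simp: rotations_def)
  have yq: "y \<in> set q0"
    using confined q(1,2) yA(2) s(2) by (auto simp: confined_def)
  then obtain xs ys where spl: "q = xs @ y # ys"
    using qs(2) by (metis split_list)
  obtain us vs where spl0: "q0 = us @ y # vs"
    using yq by (meson split_list)
  have xs: "xs \<noteq> []"
    using spl q(2) s(1) yA(1) by auto
  have us: "us \<noteq> []"
    using spl0 A yA(1) by (auto simp: rotation_closed_def)
  have dist: "distinct (xs @ y # ys)" "distinct (us @ y # vs)"
    using qs(1) q0 spl spl0 by (auto simp: path_in_def)
  \<comment> \<open>The predecessor of \<open>y\<close> on \<open>q\<close>, which the rotation
    makes the head.\<close>
  define z where "z = last xs"
  have keep: "{y, w} \<in> path_edges q" if "{y, w} \<in> path_edges q0" for w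
    using q(3)[OF that] away that yA(1) by auto
  note nb = path_edges_split_iff[OF dist(1), folded spl] path_edges_split_iff[OF dist(2), folded spl0]
  have yz: "{y, z} \<in> path_edges q0"
  proof (cases "last us = z")
    case True
    then show ?thesis using nb(2) us by auto
  next
    case False
    \<comment> \<open>Here \<open>q\<close> runs through \<open>y\<close> in the direction opposite
      to \<open>q0\<close>: \<open>last us\<close> comes after \<open>y\<close>, so \<open>y\<close>
      is not the end and its other neighbour \<open>hd vs\<close> on \<open>q0\<close> must be
      \<open>z\<close>.\<close>
    have "{y, last us} \<in> path_edges q"
      using keep nb(2) us by auto
    with False have ys: "ys \<noteq> []" "last us = hd ys"
      using nb(1) by (auto simp: z_def)
    have "y \<noteq> last q"
      using dist(1) ys(1) spl by (metis distinct.simps(2) distinct_append last_appendR last_ConsR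
          last_in_set list.discI)
    then have vs: "vs \<noteq> []"
      using qs(3) spl0 by auto
    then have "{y, hd vs} \<in> path_edges q"
      using keep nb(2) by auto
    then have "hd vs = z \<or> hd vs = last us"
      using nb(1) ys by (auto simp: z_def)
    moreover have "hd vs \<noteq> last us"
      using dist(2) us vs by (metis disjoint_iff distinct_append hd_in_set last_in_set
          list.set_intros(2))
    ultimately show ?thesis
      using nb(2) vs by auto
  qed
  define r where "r = rev xs @ y # ys"
  have r: "r \<in> rotations E V q0"
    using path_in_rotate[OF sym, of V xs y ys] qs q(2) s(2) spl xs
    by (auto simp: rotations_def r_def)
  have hdr: "hd r = z"
    using xs by (simp add: r_def z_def hd_rev)
  \<comment> \<open>The only edge lost is \<open>{z, y}\<close>, which meets
    \<open>insert z A\<close>.\<close>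
  have er: "e \<in> path_edges r \<or> e = {z, y}" if "e \<in> path_edges q" for e
    using that by (auto simp: spl r_def path_edges_append path_edges_rev z_def)
  have "rotation_closed E V q0 (insert z A)"
    unfolding rotation_closed_def
  proof (intro conjI ballI)
    show "hd q0 \<in> insert z A"
      using A by (simp add: rotation_closed_def)
    fix t assume "t \<in> insert z A"
    then consider "t = z" | "t \<in> A" by blast
    then show "\<exists>q\<in>rotations E V q0. hd q = t \<and>
        (\<forall>e\<in>path_edges q0. e \<in> path_edges q \<or> e \<inter> insert z A \<noteq> {})"
    proof cases
      case 1
      then show ?thesis
        using r hdr er q(3) by (intro bexI[of _ r]) blast+
    next
      case 2
      then show ?thesis
        using A unfolding rotation_closed_def by blast
    qed
  qed
  with that yz away show thesis by blast
qed

text \<open>Ends are collected one at a time until there are \<open>a\<close> of them. One further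
  rotation shows that each neighbour of these ends is next to some end on \<open>q0\<close>, and a
  path has at most two such places per end.\<close>

lemma rotation_expansion:
  assumes sym: "symp E" and fin: "finite V"
    and confined: "confined E V q0"
    and q0: "path_in E V q0"
    and a: "1 \<le> a"
    and expand: "\<forall>S. S \<subseteq> V \<longrightarrow> S \<noteq> {} \<longrightarrow> card S \<le> a \<longrightarrow> 2 * card S < card (nbhd E V S)"
  obtains S where "S \<subseteq> hd ` rotations E V q0" "card S = a"
    "card (nbhd E V S) \<le> 2 * card (hd ` rotations E V q0)"
proof -
  have heads: "hd ` rotations E V q0 \<subseteq> V"
    by (auto simp: rotations_def path_in_def)
  have subset: "A \<subseteq> hd ` rotations E V q0" if "rotation_closed E V q0 A" for A
    using that unfolding rotation_closed_def by (metis image_eqI subsetI)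
  have dist: "distinct q0"
    using q0 by (simp add: path_in_def)
  have "\<exists>A. rotation_closed E V q0 A \<and> card A = j" if "1 \<le> j" "j \<le> a" for j
    using that
  proof (induction j rule: nat_induct_at_least)
    case base
    have "q0 \<in> rotations E V q0"
      using q0 by (simp add: rotations_def)
    then have "rotation_closed E V q0 {hd q0}"
      by (auto simp: rotation_closed_def)
    then show ?case
      by (intro exI[of _ "{hd q0}"]) simp
  next
    case (Suc j)
    then obtain A where A: "rotation_closed E V q0 A" "card A = j"
      by auto
    have AV: "A \<subseteq> V"
      using subset[OF A(1)] heads by blast
    then have finA: "finite A"
      using fin finite_subset by blast
    have "hd q0 \<in> A"
      using A(1) by (simp add: rotation_closed_def)
    then have "A \<noteq> {}" by blast
    moreover have "card A \<le> a"
      using A(2) Suc.prems by simp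
    ultimately have "2 * card A < card (nbhd E V A)"
      using expand AV by blast
    moreover have "card (nbhd E V A) \<le> 2 * card A"
      if "nbhd E V A \<subseteq> {w. \<exists>s\<in>A. {s, w} \<in> path_edges q0}"
      using card_path_neighbours_set_le[OF dist finA] card_mono[OF _ that] by linarith
    ultimately have "\<not> nbhd E V A \<subseteq> {w. \<exists>s\<in>A. {s, w} \<in> path_edges q0}"
      by linarith
    \<comment> \<open>More than \<open>2 * card A\<close> neighbours cannot all be next to
      \<open>A\<close> on the path.\<close>
    then obtain y where y: "y \<in> nbhd E V A" "\<And>s. s \<in> A \<Longrightarrow> {s, y} \<notin> path_edges q0"
      by blast
    have "\<forall>w. {y, w} \<in> path_edges q0 \<longrightarrow> w \<notin> A"
      using y(2) by (auto simp: insert_commute)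
    then obtain z where "z \<notin> A" "rotation_closed E V q0 (insert z A)"
      using rotation_closed_extend[OF sym confined q0 A(1) y(1)] by blast
    then show ?case
      using finA A(2) by (intro exI[of _ "insert z A"]) simp
  qed
  then obtain S where S: "rotation_closed E V q0 S" "card S = a"
    using a by blast
  let ?T = "hd ` rotations E V q0"
  have finT: "finite ?T"
    using heads fin finite_subset by blast
  have "nbhd E V S \<subseteq> {w. \<exists>s\<in>?T. {s, w} \<in> path_edges q0}"
  proof
    fix y assume y: "y \<in> nbhd E V S"
    show "y \<in> {w. \<exists>s\<in>?T. {s, w} \<in> path_edges q0}"
    proof (cases "\<exists>w\<in>S. {y, w} \<in> path_edges q0")
      case True
      then obtain w where "w \<in> S" "{w, y} \<in> path_edges q0"
        by (auto simp: insert_commute)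
      then show ?thesis
        using subset[OF S(1)] by blast
    next
      case False
      then obtain z where z: "{y, z} \<in> path_edges q0" "rotation_closed E V q0 (insert z S)"
        using rotation_closed_extend[OF sym confined q0 S(1) y] by blast
      then have "z \<in> ?T" "{z, y} \<in> path_edges q0"
        using subset[OF z(2)] by (auto simp: insert_commute)
      then show ?thesis by blast
    qed
  qed
  then have "card (nbhd E V S) \<le> 2 * card ?T"
    using card_path_neighbours_set_le[OF dist finT] card_mono by (metis (no_types, lifting) le_trans)
  then show thesis
    using that subset[OF S(1)] S(2) by blast
qed

section \<open>Long cycles in expanding graphs\<close>

text \<open>Take the cycle from a longest path whose head has a neighbour as far along as possible.\<close>

lemma confining_cycle:
  assumes sym: "symp E" and fin: "finite V" and V: "V \<noteq> {}"
    and deg: "\<forall>x\<in>V. \<exists>y\<in>V. E x y"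
  obtains q0 where "cycle_in E V q0" "confined E V q0"
proof -
  obtain v where v: "v \<in> V" using V by blast
  have bound: "length p \<le> card V" if "path_in E V p" for p
    using that fin by (metis card_mono distinct_card path_in_def)
  have "path_in E V [v]"
    using v by (simp add: path_in_def)
  then obtain p where p: "path_in E V p" and longest: "\<And>q. path_in E V q \<Longrightarrow> length q \<le> length p"
    using ex_has_greatest_nat[of "path_in E V" "[v]" length "Suc (card V)"] bound by (metis le_imp_less_Suc)
  have inside: "y \<in> set q" if "path_in E V q" "length q = length p" "y \<in> V" "E (hd q) y" for q y
  proof (rule ccontr)
    assume "y \<notin> set q"
    then have "path_in E V (y # q)"
      using that sym by (cases q) (auto simp: path_in_def dest: sympD)
    then show False
      using longest that(2) by fastforce
  qed
  \<comment> \<open>Pairs of a longest path and the index of a neighbour of its head; the index is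
    to be maximal.\<close>
  define far where "far = (\<lambda>(q, i). path_in E V q \<and> length q = length p \<and> i < length q \<and> E (hd q) (q ! i))"
  have "hd p \<in> V"
    using p hd_in_set[of p] by (auto simp: path_in_def)
  then obtain y where "y \<in> V" "E (hd p) y"
    using deg by blast
  then have "y \<in> set p"
    using inside p by blast
  then obtain i where "i < length p" "p ! i = y"
    by (metis in_set_conv_nth)
  then have "far (p, i)"
    using p \<open>E (hd p) y\<close> by (simp add: far_def)
  moreover have "\<forall>y. far y \<longrightarrow> snd y \<le> length p"
    by (auto simp: far_def)
  ultimately obtain x where x: "far x" and mx: "\<And>y. far y \<Longrightarrow> snd y \<le> snd x"
    using ex_has_greatest_nat[of far "(p, i)" snd "Suc (length p)"] by (metis le_imp_less_Suc)
  obtain p' i where xpi: "x = (p', i)"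
    by (cases x) auto
  have p': "path_in E V p'" "length p' = length p" "i < length p'" "E (hd p') (p' ! i)"
    using x by (auto simp: far_def xpi)
  define q0 where "q0 = take (Suc i) p'"
  define t where "t = drop (Suc i) p'"
  have split: "p' = q0 @ t"
    by (simp add: q0_def t_def)
  have len: "length q0 = Suc i"
    using p'(3) by (simp add: q0_def)
  then have q0ne: "q0 \<noteq> []" by auto
  have "last q0 = p' ! i"
    using p'(3) by (simp add: q0_def take_Suc_conv_app_nth)
  moreover have "hd q0 = hd p'"
    using q0ne split by auto
  moreover have "path_in E V q0"
    using p'(1) q0ne by (auto simp: split path_in_def successively_append_iff)
  ultimately have cyc: "cycle_in E V q0"
    using p'(4) sym by (auto simp: cycle_in_def dest: sympD)
  \<comment> \<open>Followed by the unchanged tail \<open>t\<close>, a rotation of \<open>q0\<close>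
    is again a longest path, so its head has no neighbour beyond index \<open>i\<close>.\<close>
  have "y \<in> set q0" if q: "q \<in> rotations E V q0" and y: "y \<in> V" "E (hd q) y" for q y
  proof -
    have qq: "path_in E V q" "set q = set q0" "last q = last q0" "q \<noteq> []"
      using q by (auto simp: rotations_def path_in_def)
    have lq: "length q = Suc i"
      using qq cyc len by (metis cycle_in_def distinct_card path_in_def)
    have pt: "path_in E V (q @ t)"
      using p'(1) qq q0ne by (auto simp: split path_in_def successively_append_iff)
    have lt: "length (q @ t) = length p"
      using lq len p'(2) split by (metis length_append)
    have hq: "hd (q @ t) = hd q"
      using qq(4) by simp
    have "y \<in> set (q @ t)"
      using inside[OF pt lt y(1)] y(2) hq by simp
    then obtain j where j: "j < length (q @ t)" "(q @ t) ! j = y"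
      by (metis in_set_conv_nth)
    then have "far (q @ t, j)"
      using pt lt hq y(2) by (simp add: far_def)
    then have "j \<le> i"
      using mx xpi by fastforce
    then have "y = q ! j" "j < length q"
      using j(2) lq by (auto simp: nth_append)
    then have "y \<in> set q"
      by simp
    then show ?thesis
      unfolding qq(2) .
  qed
  with cyc that show thesis by (auto simp: confined_def)
qed

text \<open>In the application \<open>M\<close> and \<open>a\<close> are the largest and the second
  largest part size, and both expansion hypotheses hold because no set of either size can serve as a
  part.\<close>

lemma long_cycle_of_expansion:
  assumes sym: "symp E" and fin: "finite V" and V: "a \<le> card V" and a: "1 \<le> a"
    and small: "\<forall>S. S \<subseteq> V \<longrightarrow> card S = a \<longrightarrow> 2 * M + 5 * a \<le> card (nbhd E V S)"
    and large: "\<forall>S. S \<subseteq> V \<longrightarrow> card S = M \<longrightarrow> n \<le> card (S \<union> nbhd E V S)"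
  obtains q where "cycle_in E V q" "n \<le> length q"
proof -
  define bad where "bad = (\<lambda>B. B \<subseteq> V \<and> card B \<le> a \<and> card (nbhd E V B) \<le> 2 * card B)"
  have "bad {}"
    by (simp add: bad_def nbhd_def)
  moreover have "\<forall>B. bad B \<longrightarrow> card B \<le> a"
    by (simp add: bad_def)
  ultimately obtain B where B: "bad B" and maxB: "\<And>B'. bad B' \<Longrightarrow> card B' \<le> card B"
    using ex_has_greatest_nat[of bad "{}" card "Suc a"] by (metis le_imp_less_Suc)
  have BV: "B \<subseteq> V" and NB: "card (nbhd E V B) \<le> 2 * card B"
    using B by (auto simp: bad_def)
  have finB: "finite B"
    using BV fin finite_subset by blast
  have "card B \<noteq> a"
  proof
    assume B: "card B = a"
    then have "2 * M + 5 * a \<le> card (nbhd E V B)"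
      using small BV by blast
    then show False
      using B NB a by linarith
  qed
  then have Ba: "card B < a"
    using B by (simp add: bad_def)
  define W where "W = V - B"
  have finW: "finite W" and WV: "W \<subseteq> V"
    using fin by (auto simp: W_def)
  have "W \<noteq> {}"
    using Ba V BV by (metis Diff_eq_empty_iff W_def finB card_mono leD less_le_trans)
  \<comment> \<open>Adding a poorly expanding \<open>S\<close> to \<open>B\<close> keeps the bound
    on neighbours: the union is a larger bad set, or it is big enough to contain an
    \<open>a\<close>-set violating \<open>small\<close>.\<close>
  have expand: "\<forall>S. S \<subseteq> W \<longrightarrow> S \<noteq> {} \<longrightarrow> card S \<le> a \<longrightarrow> 2 * card S < card (nbhd E W S)"
  proof (intro allI impI, rule ccontr)
    fix S
    assume S: "S \<subseteq> W" "S \<noteq> {}" "card S \<le> a" and "\<not> 2 * card S < card (nbhd E W S)"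
    then have NS: "card (nbhd E W S) \<le> 2 * card S" by simp
    have finS: "finite S"
      using S(1) finW finite_subset by blast
    have disj: "card (B \<union> S) = card B + card S"
      using S(1) finB finS by (intro card_Un_disjoint) (auto simp: W_def)
    have sub: "nbhd E V (B \<union> S) \<subseteq> nbhd E V B \<union> nbhd E W S"
      by (auto simp: nbhd_def W_def)
    have NBS: "card (nbhd E V (B \<union> S)) \<le> 2 * card (B \<union> S)"
    proof -
      have "card (nbhd E V (B \<union> S)) \<le> card (nbhd E V B \<union> nbhd E W S)"
        using sub fin finW by (intro card_mono) auto
      also have "\<dots> \<le> card (nbhd E V B) + card (nbhd E W S)"
        by (rule card_Un_le)
      finally show ?thesis
        using NB NS disj by linarith
    qed
    have BSV: "B \<union> S \<subseteq> V"
      using BV S(1) WV by blast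
    show False
    proof (cases "card (B \<union> S) \<le> a")
      case True
      then have "bad (B \<union> S)"
        using NBS BSV by (simp add: bad_def)
      then have "card (B \<union> S) \<le> card B"
        by (rule maxB)
      moreover have "0 < card S"
        using S(2) finS by (simp add: card_gt_0_iff)
      ultimately show False
        using disj by linarith
    next
      case False
      \<comment> \<open>Neighbours of \<open>T\<close> lie in \<open>B \<union> S - T\<close> or are
        neighbours of \<open>B \<union> S\<close>, so there are at most
        \<open>3 * card (B \<union> S) - a < 5 * a\<close> of them.\<close>
      then obtain T where T: "T \<subseteq> B \<union> S" "card T = a"
        by (meson nle_le obtain_subset_with_card_n)
      have finBS: "finite (B \<union> S)"
        using finB finS by blast
      have "nbhd E V T \<subseteq> (B \<union> S - T) \<union> nbhd E V (B \<union> S)"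
        using T(1) by (auto simp: nbhd_def)
      then have "card (nbhd E V T) \<le> card ((B \<union> S - T) \<union> nbhd E V (B \<union> S))"
        using fin finBS by (intro card_mono) auto
      also have "\<dots> \<le> card (B \<union> S - T) + card (nbhd E V (B \<union> S))"
        by (rule card_Un_le)
      also have "card (B \<union> S - T) = card (B \<union> S) - a"
        using T finBS by (simp add: card_Diff_subset finite_subset)
      finally have "card (nbhd E V T) \<le> 3 * card (B \<union> S) - a"
        using NBS False by linarith
      moreover have "card (B \<union> S) < 2 * a"
        using disj Ba S(3) by linarith
      moreover have "2 * M + 5 * a \<le> card (nbhd E V T)"
        using small T BSV by blast
      ultimately show False
        by linarith
    qed
  qed
  have deg: "\<forall>x\<in>W. \<exists>y\<in>W. E x y"
  proof
    fix x assume "x \<in> W"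
    then have "2 * card {x} < card (nbhd E W {x})"
      using expand[rule_format, of "{x}"] a by simp
    then have "nbhd E W {x} \<noteq> {}"
      by auto
    then show "\<exists>y\<in>W. E x y"
      by (auto simp: nbhd_def)
  qed
  obtain q0 where cyc: "cycle_in E W q0"
    and confined: "confined E W q0"
    using confining_cycle[OF sym finW \<open>W \<noteq> {}\<close> deg] by blast
  have q0: "path_in E W q0"
    using cyc by (simp add: cycle_in_def)
  let ?T = "hd ` rotations E W q0"
  obtain S where S: "S \<subseteq> ?T" "card S = a" "card (nbhd E W S) \<le> 2 * card ?T"
    using rotation_expansion[OF sym finW confined q0 a expand] by blast
  have TW: "?T \<subseteq> set q0" "set q0 \<subseteq> W"
    using q0 by (auto simp: rotations_def path_in_def)
  have SV: "S \<subseteq> V"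
    using S(1) TW WV by blast
  have "nbhd E V S \<subseteq> nbhd E W S \<union> B"
    by (auto simp: nbhd_def W_def)
  then have "card (nbhd E V S) \<le> card (nbhd E W S \<union> B)"
    using finW finB by (intro card_mono) auto
  also have "\<dots> \<le> card (nbhd E W S) + card B"
    by (rule card_Un_le)
  finally have "card (nbhd E V S) \<le> card (nbhd E W S) + card B" .
  moreover have "2 * M + 5 * a \<le> card (nbhd E V S)"
    using small SV S(2) by blast
  \<comment> \<open>Indeed \<open>2 * M + 5 * a \<le> 2 * card ?T + card B\<close>, and
    \<open>card B < a\<close>.\<close>
  ultimately have T: "M + 2 * a < card ?T"
    using S(3) Ba by linarith
  have "card ?T - card (nbhd E V B) \<le> card (?T - nbhd E V B)"
    using fin by (intro diff_card_le_card_Diff) simp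
  then have "M \<le> card (?T - nbhd E V B)"
    using T NB Ba by linarith
  then obtain R where R: "R \<subseteq> ?T - nbhd E V B" "card R = M"
    by (meson obtain_subset_with_card_n)
  have "R \<union> nbhd E V R \<subseteq> set q0"
  proof
    fix y assume "y \<in> R \<union> nbhd E V R"
    then consider "y \<in> R" | s where "y \<in> V" "s \<in> R" "E s y"
      by (auto simp: nbhd_def)
    then show "y \<in> set q0"
    proof cases
      case 1
      then show ?thesis using R TW by blast
    next
      case 2
      then have s: "s \<in> ?T" "s \<notin> nbhd E V B" "s \<in> V" "s \<notin> B"
        using R TW by (auto simp: W_def)
      \<comment> \<open>Otherwise \<open>s\<close> would be a neighbour of \<open>B\<close>; so
        passing from \<open>V\<close> to \<open>W\<close> loses no neighbour of
        \<open>R\<close>.\<close>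
      have "y \<notin> B"
        using s 2 sym by (auto simp: nbhd_def dest: sympD)
      then have "y \<in> W"
        using 2 by (simp add: W_def)
      then show ?thesis
        using confined s(1) 2(3) by (auto simp: confined_def)
    qed
  qed
  then have "card (R \<union> nbhd E V R) \<le> card (set q0)"
    by (intro card_mono) auto
  moreover have "card (set q0) = length q0"
    using q0 by (simp add: path_in_def distinct_card)
  moreover have "n \<le> card (R \<union> nbhd E V R)"
    using large R TW WV by (metis (no_types, lifting) Diff_subset order_trans)
  moreover have "cycle_in E V q0"
    using cyc WV by (auto simp: cycle_in_def path_in_def)
  ultimately show thesis
    using that by simp
qed

section \<open>Separated parts and the induction on the number of parts\<close>

text \<open>With \<open>E\<close> as red adjacency, all edges between the two sets are blue.
  Disjointness is demanded separately because \<open>E\<close> need not be reflexive.\<close>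

definition separated :: "('a \<Rightarrow> 'a \<Rightarrow> bool) \<Rightarrow> 'a set \<Rightarrow> 'a set \<Rightarrow> bool" where
  "separated E X Y \<longleftrightarrow> X \<inter> Y = {} \<and> (\<forall>x\<in>X. \<forall>y\<in>Y. \<not> E x y)"

lemma separated_commute: "symp E \<Longrightarrow> separated E X Y \<longleftrightarrow> separated E Y X"
  by (auto simp: separated_def dest: sympD)

lemma separated_outside_nbhd:
  "S \<subseteq> V \<Longrightarrow> X \<subseteq> V - (S \<union> nbhd E V S) \<Longrightarrow> separated E S X"
  by (auto simp: separated_def nbhd_def)

definition separated_parts :: "('a \<Rightarrow> 'a \<Rightarrow> bool) \<Rightarrow> 'a set \<Rightarrow> nat \<Rightarrow> (nat \<Rightarrow> nat) \<Rightarrow> (nat \<Rightarrow> 'a set) \<Rightarrow> bool" where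
  "separated_parts E V k m A \<longleftrightarrow>
     (\<forall>i\<in>{1..k}. A i \<subseteq> V \<and> card (A i) = m i) \<and>
     (\<forall>i\<in>{1..k}. \<forall>j\<in>{1..k}. i \<noteq> j \<longrightarrow> separated E (A i) (A j))"

text \<open>\<open>S\<close> takes position \<open>l\<close>, and the part found outside in position
  \<open>l\<close>, which has size \<open>m (Suc k)\<close>, moves to position \<open>Suc k\<close>.
  For \<open>l = Suc k\<close> nothing moves.\<close>

lemma separated_parts_extend:
  assumes sym: "symp E" and l: "l \<in> {1..Suc k}" and S: "S \<subseteq> V" "card S = m l"
    and A: "separated_parts E (V - (S \<union> nbhd E V S)) k (m(l := m (Suc k))) A"
  obtains A' where "separated_parts E V (Suc k) m A'"
proof -
  define \<sigma> where "\<sigma> i = (if i = Suc k then l else i)" for i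
  define A' where "A' i = (if i = l then S else A (\<sigma> i))" for i
  have \<sigma>: "\<sigma> i \<in> {1..k}" if "i \<in> {1..Suc k}" "i \<noteq> l" for i
    using that l by (auto simp: \<sigma>_def)
  have part: "A (\<sigma> i) \<subseteq> V - (S \<union> nbhd E V S) \<and> card (A (\<sigma> i)) = m i"
    if "i \<in> {1..Suc k}" "i \<noteq> l" for i
    using A \<sigma>[OF that] that by (auto simp: separated_parts_def \<sigma>_def split: if_splits)
  have sep: "separated E S (A (\<sigma> i))" "separated E (A (\<sigma> i)) S" if "i \<in> {1..Suc k}" "i \<noteq> l" for i
    using part[OF that] separated_outside_nbhd[OF S(1)] separated_commute[OF sym] by blast+
  have "separated E (A' i) (A' j)" if ij: "i \<in> {1..Suc k}" "j \<in> {1..Suc k}" "i \<noteq> j" for i j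
  proof (cases "i = l \<or> j = l")
    case True
    then show ?thesis
      using sep ij by (auto simp: A'_def)
  next
    case False
    then have "\<sigma> i \<noteq> \<sigma> j"
      using ij by (auto simp: \<sigma>_def)
    then have "separated E (A (\<sigma> i)) (A (\<sigma> j))"
      using A \<sigma> ij False unfolding separated_parts_def by blast
    then show ?thesis
      using False by (simp add: A'_def)
  qed
  moreover have "A' i \<subseteq> V \<and> card (A' i) = m i" if "i \<in> {1..Suc k}" for i
    using part[OF that] S by (auto simp: A'_def)
  ultimately show thesis
    using that[of A'] by (simp add: separated_parts_def)
qed

text \<open>The induction changes both the vertex set and the sizes, hence the general
  \<open>V\<close> and \<open>m\<close>. The conditional makes the second largest size 0 when there
  is only one part.\<close>

lemma separated_parts_or_long_cycle:
  assumes "symp E" "finite V" "1 \<le> k" "\<And>i. i \<in> {1..k} \<Longrightarrow> 1 \<le> m i"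
    and "\<And>i j. 1 \<le> i \<Longrightarrow> i \<le> j \<Longrightarrow> j \<le> k \<Longrightarrow> m i \<le> m j"
    and "3 * m k + 5 * (if k = 1 then 0 else m (k - 1)) \<le> n"
    and "(k - 1) * (n - 1) + m 1 \<le> card V"
    and "\<forall>q. cycle_in E V q \<longrightarrow> length q < n"
  shows "\<exists>A. separated_parts E V k m A"
  using assms
proof (induction k arbitrary: V m)
  case 0
  then show ?case by simp
next
  case (Suc k)
  note sym = \<open>symp E\<close> and fin = \<open>finite V\<close> and pos = Suc.prems(4) and mono = Suc.prems(5)
  show ?case
  proof (cases "k = 0")
    case True
    then have "m 1 \<le> card V"
      using Suc.prems(7) by simp
    then obtain X where "X \<subseteq> V" "card X = m 1"
      by (meson obtain_subset_with_card_n)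
    then have "separated_parts E V (Suc k) m (\<lambda>_. X)"
      using True by (simp add: separated_parts_def)
    then show ?thesis by blast
  next
    case False
    let ?a = "m k" and ?M = "m (Suc k)"
    have a: "1 \<le> ?a" "?a \<le> ?M"
      using pos[of k] mono[of k "Suc k"] False by auto
    have prev: "m (k - 1) \<le> ?a" if "k \<noteq> 1"
      using mono[of "k - 1" k] that False by auto
    have n: "3 * ?M + 5 * ?a \<le> n"
      using Suc.prems(6) False by simp
    have V: "k * (n - 1) + m 1 \<le> card V"
      using Suc.prems(7) by simp
    have kn: "k * (n - 1) = (k - 1) * (n - 1) + (n - 1)"
      using False by (cases k) auto
    show ?thesis
    proof (rule ccontr)
      assume none: "\<not> ?thesis"
      text \<open>A poorly expanding set serves as the \<open>l\<close>-th part.\<close>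
      have expand: "card V < (k - 1) * (n - 1) + (m(l := ?M)) 1 + card (S \<union> nbhd E V S)"
        if S: "S \<subseteq> V" "card S = m l" and l: "l = k \<or> l = Suc k" for S l
      proof (rule ccontr)
        assume few: "\<not> ?thesis"
        let ?U = "V - (S \<union> nbhd E V S)" and ?m = "m(l := ?M)"
        have "card V - card (S \<union> nbhd E V S) \<le> card ?U"
          using S(1) fin by (intro diff_card_le_card_Diff) (auto intro: finite_subset)
        have "\<exists>A. separated_parts E ?U k ?m A"
        proof (rule Suc.IH[OF sym])
          show "finite ?U" "1 \<le> k"
            using fin False by auto
          show "1 \<le> ?m i" if "i \<in> {1..k}" for i
            using pos[of i] that a by auto
          show "?m i \<le> ?m j" if "1 \<le> i" "i \<le> j" "j \<le> k" for i j
            using mono[of i j] mono[of i "Suc k"] that l by auto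
          \<comment> \<open>After the exchange the last size is at most \<open>?M\<close>, and the
            one before it, if any, is \<open>m (k - 1) \<le> ?a\<close>.\<close>
          show "3 * ?m k + 5 * (if k = 1 then 0 else ?m (k - 1)) \<le> n"
            using n a prev l False by (cases "k = 1") auto
          show "(k - 1) * (n - 1) + ?m 1 \<le> card ?U"
            using few \<open>_ \<le> card ?U\<close> by linarith
          show "\<forall>q. cycle_in E ?U q \<longrightarrow> length q < n"
            using Suc.prems(8) by (auto simp: cycle_in_def path_in_def)
        qed
        then obtain A where A: "separated_parts E ?U k ?m A" by blast
        have "l \<in> {1..Suc k}"
          using l False by auto
        then obtain A' where "separated_parts E V (Suc k) m A'"
          using separated_parts_extend[OF sym _ S(1) S(2) A] by blast
        then show False
          using none by blast
      qed
      have large: "\<forall>S. S \<subseteq> V \<longrightarrow> card S = ?M \<longrightarrow> n \<le> card (S \<union> nbhd E V S)"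
      proof (intro allI impI)
        fix S assume "S \<subseteq> V" "card S = ?M"
        \<comment> \<open>For \<open>l = Suc k\<close> the update of \<open>m\<close> is
          trivial.\<close>
        then have "card V < (k - 1) * (n - 1) + m 1 + card (S \<union> nbhd E V S)"
          using expand[of S "Suc k"] by simp
        then show "n \<le> card (S \<union> nbhd E V S)"
          using V kn by linarith
      qed
      have small: "\<forall>S. S \<subseteq> V \<longrightarrow> card S = ?a \<longrightarrow> 2 * ?M + 5 * ?a \<le> card (nbhd E V S)"
      proof (intro allI impI)
        fix S assume S: "S \<subseteq> V" "card S = ?a"
        \<comment> \<open>The update affects \<open>m 1\<close> only if \<open>k = 1\<close>, and
          then equality holds. Hence \<open>S\<close> has at least \<open>n - ?M\<close>
          neighbours.\<close>
        have "(m(k := ?M)) 1 + ?a \<le> m 1 + ?M"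
          using a by auto
        moreover have "card V < (k - 1) * (n - 1) + (m(k := ?M)) 1 + card (S \<union> nbhd E V S)"
          using expand[of S k] S by blast
        ultimately show "2 * ?M + 5 * ?a \<le> card (nbhd E V S)"
          using V kn n card_Un_le[of S "nbhd E V S"] S(2) by linarith
      qed
      have "n - 1 \<le> k * (n - 1)"
        using False by simp
      then have "?a \<le> card V"
        using V n a by linarith
      then obtain q where "cycle_in E V q" "n \<le> length q"
        using long_cycle_of_expansion[OF sym fin _ a(1) small large] by blast
      then show False
        using Suc.prems(8) by fastforce
    qed
  qed
qed

section \<open>From lists and set families to copies in the coloured complete graph\<close>

lemma contains_cycle_of_cycle_in:
  assumes cyc: "cycle_in (\<lambda>u v. c {u, v} = Red) {..<N} q" and n: "n \<le> length q" "3 \<le> n"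
  shows "contains_cycle_at_least n (colour_class c Red (complete_graph N))"
proof -
  let ?l = "length q"
  have q: "q \<noteq> []" "distinct q" "set q \<subseteq> {..<N}" "successively (\<lambda>u v. c {u, v} = Red) q"
    "c {last q, hd q} = Red"
    using cyc by (auto simp: cycle_in_def path_in_def)
  have col: "c {q ! i, q ! (Suc i mod ?l)} = Red" if "i < ?l" for i
  proof (cases "Suc i < ?l")
    case True
    then show ?thesis
      using q(4) successively_nth[of _ q i] by simp
  next
    case False
    \<comment> \<open>The last index, where the successor wraps around to 0.\<close>
    then have i: "Suc i = ?l" using that by simp
    then have "q ! i = last q" "q ! (Suc i mod ?l) = hd q"
      using q(1) by (auto simp: last_conv_nth hd_conv_nth simp flip: i)
    then show ?thesis
      using q(5) by simp
  qed
  have "{q ! i, q ! (Suc i mod ?l)} \<in> nsets {..<N} 2" if "i < ?l" for i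
  proof -
    have l: "Suc i mod ?l < ?l" "Suc i mod ?l \<noteq> i"
      using that n by (auto simp: mod_Suc)
    then have "q ! i \<noteq> q ! (Suc i mod ?l)"
      using q(2) that by (metis nth_eq_iff_index_eq)
    then show ?thesis
      using q(3) l(1) that nth_mem by (fastforce simp: nsets_def card_insert_if)
  qed
  with col have "contains_copy (colour_class c Red (complete_graph N)) (cycle_graph ?l)"
    unfolding contains_copy_def colour_class_def complete_graph_def cycle_graph_def
    using q(2,3) nth_mem by (intro exI[of _ "nth q"]) (fastforce simp: inj_on_def nth_eq_iff_index_eq)
  then show ?thesis
    using n unfolding contains_cycle_at_least_def by (intro exI[of _ ?l]) simp
qed

lemma contains_multipartite_of_separated_parts:
  assumes parts: "separated_parts (\<lambda>u v. c {u, v} = Red) {..<N} k m A"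
  shows "contains_copy (colour_class c Blue (complete_graph N)) (complete_multipartite k m)"
proof -
  have A: "A i \<subseteq> {..<N} \<and> card (A i) = m i" if "i \<in> {1..k}" for i
    using parts that by (simp add: separated_parts_def)
  have "\<exists>h. bij_betw h {..<m i} (A i)" if "i \<in> {1..k}" for i
    using A[OF that] by (metis bij_betw_from_nat_into_finite finite_lessThan finite_subset)
  then obtain h where h: "\<And>i. i \<in> {1..k} \<Longrightarrow> bij_betw (h i) {..<m i} (A i)"
    by metis
  define f where "f = (\<lambda>(i, j). h i j)"
  let ?V = "SIGMA i:{1..k}. {..<m i}"
  have fA: "f x \<in> A (fst x)" if "x \<in> ?V" for x
    using that bij_betwE[OF h] by (auto simp: f_def)
  have cross: "f x \<noteq> f y \<and> c {f x, f y} = Blue" if "x \<in> ?V" "y \<in> ?V" "fst x \<noteq> fst y" for x y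
  proof -
    have "separated (\<lambda>u v. c {u, v} = Red) (A (fst x)) (A (fst y))"
      using parts that by (auto simp: separated_parts_def)
    then have "f x \<noteq> f y" "c {f x, f y} \<noteq> Red"
      using fA[OF that(1)] fA[OF that(2)] unfolding separated_def by auto
    then show ?thesis
      using colour.exhaust by blast
  qed
  have "inj_on f ?V"
  proof (rule inj_onI)
    fix x y assume xy: "x \<in> ?V" "y \<in> ?V" "f x = f y"
    then have "fst x = fst y"
      using cross by blast
    then show "x = y"
      using xy h by (auto simp: f_def bij_betw_def inj_on_def)
  qed
  moreover have "f ` ?V \<subseteq> {..<N}"
    using fA A by fastforce
  moreover have "f ` {x, y} \<in> nsets {..<N} 2 \<and> c (f ` {x, y}) = Blue"
    if "x \<in> ?V" "y \<in> ?V" "fst x \<noteq> fst y" for x y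
    using cross[OF that] fA[OF that(1)] fA[OF that(2)] A that
    by (fastforce simp: nsets_def card_insert_if)
  ultimately show ?thesis
    unfolding contains_copy_def colour_class_def complete_graph_def complete_multipartite_def Let_def
    by (intro exI[of _ f]) auto
qed

section \<open>The lower bound\<close>

text \<open>The extremal colouring: red cliques on blocks of \<open>d = n - 1\<close> consecutive vertices.\<close>

definition block_colouring :: "nat \<Rightarrow> nat set \<Rightarrow> colour" where
  "block_colouring d e = (if \<exists>b. \<forall>x\<in>e. x div d = b then Red else Blue)"

lemma block_colouring_pair: "block_colouring d {x, y} = Red \<longleftrightarrow> x div d = y div d"
  by (auto simp: block_colouring_def)

text \<open>A red cycle never leaves its block, and a block has only \<open>d\<close>
  vertices.\<close>

lemma block_colouring_no_long_cycle:
  assumes "0 < d"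
  shows "\<not> contains_cycle_at_least (Suc d) (colour_class (block_colouring d) Red (complete_graph N))"
proof
  assume "contains_cycle_at_least (Suc d) (colour_class (block_colouring d) Red (complete_graph N))"
  then obtain l f where l: "Suc d \<le> l" and f: "inj_on f {..<l}"
    "\<forall>e \<in> {{i, Suc i mod l} | i. i < l}. block_colouring d (f ` e) = Red"
    unfolding contains_cycle_at_least_def contains_copy_def colour_class_def cycle_graph_def
    by auto
  have edges: "block_colouring d (f ` {i, Suc i mod l}) = Red" if "i < l" for i
    using f(2) that by blast
  note inj = f(1)
  have "f i div d = f 0 div d" if "i < l" for i
    using that
  proof (induction i)
    case (Suc i)
    then show ?case
      using edges[of i] by (simp add: block_colouring_pair)
  qed simp
  moreover have "x \<in> {x div d * d..<x div d * d + d}" for x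
    using dividend_less_div_times[OF assms, of x] by (simp add: add.commute)
  ultimately have "f ` {..<l} \<subseteq> {f 0 div d * d..<f 0 div d * d + d}"
    by (metis (no_types, lifting) image_subsetI lessThan_iff)
  then have "card (f ` {..<l}) \<le> card {f 0 div d * d..<f 0 div d * d + d}"
    by (intro card_mono) auto
  then show False
    using l inj by (simp add: card_image)
qed

text \<open>Different parts use different blocks, and only \<open>k\<close> blocks are available. So
  some part lies entirely in the last block, which has fewer than \<open>m 1\<close>
  vertices.\<close>

lemma block_colouring_no_multipartite:
  assumes k: "1 \<le> k" and pos: "\<And>i. i \<in> {1..k} \<Longrightarrow> 1 \<le> m i"
    and m1: "\<And>i. i \<in> {1..k} \<Longrightarrow> m 1 \<le> m i" and d: "m 1 \<le> d"
    and N: "N < (k - 1) * d + m 1"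
  shows "\<not> contains_copy (colour_class (block_colouring d) Blue (complete_graph N))
    (complete_multipartite k m)"
proof
  let ?V = "SIGMA i:{1..k}. {..<m i}"
  assume "contains_copy (colour_class (block_colouring d) Blue (complete_graph N))
    (complete_multipartite k m)"
  then obtain f where inj: "inj_on f ?V" and fN: "f ` ?V \<subseteq> {..<N}"
    and edges: "\<forall>e \<in> {{x, y} | x y. x \<in> ?V \<and> y \<in> ?V \<and> fst x \<noteq> fst y}. block_colouring d (f ` e) = Blue"
    unfolding contains_copy_def colour_class_def complete_graph_def complete_multipartite_def Let_def
    by auto
  have diff: "f x div d \<noteq> f y div d" if "x \<in> ?V" "y \<in> ?V" "fst x \<noteq> fst y" for x y
  proof -
    have "block_colouring d (f ` {x, y}) = Blue"
      using edges that by blast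
    then show ?thesis
      using block_colouring_pair[of d "f x" "f y"] by simp
  qed
  have "N < k * d"
    using N d k by (cases k) auto
  have lt: "f x div d < k" if "x \<in> ?V" for x
  proof -
    have "f x < k * d"
      using fN that \<open>N < k * d\<close> by fastforce
    then show ?thesis
      by (simp add: less_mult_imp_div_less)
  qed
  have rep: "(i, 0) \<in> ?V" if "i \<in> {1..k}" for i
    using pos[OF that] that by auto
  define g where "g i = f (i, 0) div d" for i
  have "inj_on g {1..k}"
  proof (rule inj_onI)
    fix i i' assume "i \<in> {1..k}" "i' \<in> {1..k}" "g i = g i'"
    then show "i = i'"
      using diff[OF rep rep, of i i'] by (auto simp: g_def)
  qed
  moreover have "g ` {1..k} \<subseteq> {..<k}"
    using lt rep by (auto simp: g_def)
  ultimately have surj: "g ` {1..k} = {..<k}"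
    by (intro card_subset_eq) (auto simp: card_image)
  then obtain i where i: "i \<in> {1..k}" "g i = k - 1"
    using k by (metis (no_types, lifting) diff_less imageE lessThan_iff less_le_trans zero_less_one)
  have "f (i, j) \<in> {(k - 1) * d..<N}" if j: "j < m i" for j
  proof -
    have x: "(i, j) \<in> ?V"
      using i j by auto
    \<comment> \<open>Every block contains the representative \<open>(i', 0)\<close> of some part,
      and a vertex of another part cannot share that block.\<close>
    obtain i' where i': "i' \<in> {1..k}" "g i' = f (i, j) div d"
      using lt[OF x] surj by (metis imageE lessThan_iff)
    then have "i' = i"
      using diff[OF x rep[OF i'(1)]] by (auto simp: g_def)
    then have "f (i, j) div d = k - 1"
      using i i' by simp
    then have "(k - 1) * d \<le> f (i, j)"
      by (metis div_times_less_eq_dividend)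
    moreover have "f (i, j) \<in> {..<N}"
      using fN x by blast
    ultimately show ?thesis by simp
  qed
  then have "(\<lambda>j. f (i, j)) ` {..<m i} \<subseteq> {(k - 1) * d..<N}"
    by auto
  then have "card ((\<lambda>j. f (i, j)) ` {..<m i}) \<le> card {(k - 1) * d..<N}"
    by (intro card_mono) auto
  moreover have "inj_on (\<lambda>j. f (i, j)) {..<m i}"
  proof (rule inj_onI)
    fix j j' assume "j \<in> {..<m i}" "j' \<in> {..<m i}" "f (i, j) = f (i, j')"
    then show "j = j'"
      using inj_onD[OF inj, of "(i, j)" "(i, j')"] i(1) by simp
  qed
  ultimately have "m i \<le> N - (k - 1) * d"
    by (simp add: card_image)
  \<comment> \<open>If the last block is empty, the difference is truncated to 0 and
    \<open>1 \<le> m 1\<close> is what counts.\<close>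
  moreover have "N - (k - 1) * d < m 1"
    using N pos[of 1] k by (simp add: less_diff_conv2 add.commute split: nat_diff_split)
  ultimately show False
    using m1[OF i(1)] by (meson leD le_trans)
qed

theorem theorem1p2:
  fixes k n :: nat and m :: "nat \<Rightarrow> nat"
  assumes "k \<ge> 1"
    and "\<And>i. i \<in> {1..k} \<Longrightarrow> m i \<ge> 1"
    and "\<And>i j. 1 \<le> i \<Longrightarrow> i \<le> j \<Longrightarrow> j \<le> k \<Longrightarrow> m i \<le> m j"
    and "n \<ge> 3 * m k + 5 * (if k = 1 then 0 else m (k - 1))"
  shows "ramsey_long_cycle n (complete_multipartite k m) = (k - 1) * (n - 1) + m 1"
  unfolding ramsey_long_cycle_def
proof (rule Least_equality)
  have n: "3 * m k \<le> n" "1 \<le> m k" "m 1 \<le> m k"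
    using assms by auto
  let ?N = "(k - 1) * (n - 1) + m 1"
  show "\<forall>c. contains_cycle_at_least n (colour_class c Red (complete_graph ?N)) \<or>
      contains_copy (colour_class c Blue (complete_graph ?N)) (complete_multipartite k m)"
  proof
    fix c :: "nat set \<Rightarrow> colour"
    let ?E = "\<lambda>u v. c {u, v} = Red"
    show "contains_cycle_at_least n (colour_class c Red (complete_graph ?N)) \<or>
      contains_copy (colour_class c Blue (complete_graph ?N)) (complete_multipartite k m)"
    proof (cases "\<exists>q. cycle_in ?E {..<?N} q \<and> n \<le> length q")
      case True
      then obtain q where q: "cycle_in ?E {..<?N} q" "n \<le> length q"
        by blast
      have "3 \<le> n"
        using n by linarith
      then show ?thesis
        using contains_cycle_of_cycle_in[OF q] by blast
    next
      case False
      have "\<exists>A. separated_parts ?E {..<?N} k m A"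
      proof (rule separated_parts_or_long_cycle[OF _ _ assms])
        show "symp ?E"
          by (simp add: symp_def insert_commute)
        show "\<forall>q. cycle_in ?E {..<?N} q \<longrightarrow> length q < n"
          using False by (simp add: not_le)
      qed simp_all
      then show ?thesis
        using contains_multipartite_of_separated_parts by blast
    qed
  qed
next
  fix N
  assume *: "\<forall>c. contains_cycle_at_least n (colour_class c Red (complete_graph N)) \<or>
      contains_copy (colour_class c Blue (complete_graph N)) (complete_multipartite k m)"
  have n: "3 * m k \<le> n" "1 \<le> m k" "m 1 \<le> m k"
    using assms by auto
  then have d: "Suc (n - 1) = n" "0 < n - 1" "m 1 \<le> n - 1"
    by linarith+
  have "contains_copy (colour_class (block_colouring (n - 1)) Blue (complete_graph N))
      (complete_multipartite k m)"
    \<comment> \<open>Blocks of size \<open>n - 1\<close> exclude the red alternative;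
      \<open>1 \<le> n\<close> ensures \<open>Suc (n - 1) = n\<close>.\<close>
    using * block_colouring_no_long_cycle[OF d(2), of N] d(1) by auto
  moreover have "m 1 \<le> m i" if "i \<in> {1..k}" for i
    using assms(3)[of 1 i] that by auto
  ultimately show "(k - 1) * (n - 1) + m 1 \<le> N"
    using block_colouring_no_multipartite[of k m "n - 1" N] assms(1,2) d(3) by fastforce
qed

end
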